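(* The universal Burnside kei $\bar Q(3,4)$ has exactly $96$ elements.
   Context: A kei (also called an involutory quandle) is a set $Q$ with a binary operation $*\colon Q\times Q\to Q$ such that for all $a,b,c\in Q$: (i) $a*a=a$; (ii) $(a*b)*b=a$; (iii) $(a*b)*c=(a*c)*(b*c)$. Omitted parentheses denote left association: $a*b*c=(a*b)*c$. For $n\ge 1$, the universal relation $r_n$ is the identity $a=\dots *a*b*\dots *a*b$, required for all elements $a,b$ of the kei, where the right-hand side is the left-normed product of $n$ letters alternating between $a$ and $b$ and ending in $b$; in particular $r_4$ is $a=a*b*a*b$. The universal Burnside kei $\bar Q(k,n)$ is the free kei on $k$ generators in the class of keis satisfying $r_n$ (the quotient of the free kei on $k$ generators by the relation $r_n$ imposed on all pairs of elements). Thus $\bar Q(3,4)$ is the free object on $3$ generators in the class of keis satisfying $a=a*b*a*b$ for all elements $a,b$. *)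

theory Defs
  imports Main
begin

locale kei =
  fixes Q :: "'a set" and m :: "'a \<Rightarrow> 'a \<Rightarrow> 'a"  (infixl "\<star>" 70)
  assumes closed: "a \<in> Q \<Longrightarrow> b \<in> Q \<Longrightarrow> a \<star> b \<in> Q"
    and idem: "a \<in> Q \<Longrightarrow> a \<star> a = a"
    and invol: "a \<in> Q \<Longrightarrow> b \<in> Q \<Longrightarrow> (a \<star> b) \<star> b = a"
    and distrib: "a \<in> Q \<Longrightarrow> b \<in> Q \<Longrightarrow> c \<in> Q \<Longrightarrow> (a \<star> b) \<star> c = (a \<star> c) \<star> (b \<star> c)"

text \<open>The left-normed product of \<open>n\<close> letters alternating between \<open>a\<close> and \<open>b\<close> and ending
  in \<open>b\<close>, for \<open>n \<ge> 1\<close>. The value at \<open>0\<close> is a convention which makes the relation \<open>r\<^sub>0\<close>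
  vacuous.\<close>

fun alternating :: "('a \<Rightarrow> 'a \<Rightarrow> 'a) \<Rightarrow> nat \<Rightarrow> 'a \<Rightarrow> 'a \<Rightarrow> 'a" where
  "alternating m 0 a b = a"
| "alternating m (Suc 0) a b = b"
| "alternating m (Suc (Suc n)) a b = m (alternating m (Suc n) b a) b"

lemma alternating_4: "alternating m 4 a b = m (m (m a b) a) b"
  by (simp add: numeral_eq_Suc)

locale burnside_kei = kei +
  fixes n :: nat
  assumes r: "a \<in> Q \<Longrightarrow> b \<in> Q \<Longrightarrow> a = alternating m n a b"

text \<open>The free object on \<open>k\<close> generators is built as the set of formal products of the letters
  \<open>Gen 0, \<dots>, Gen (k - 1)\<close> modulo the least congruence enforcing the kei axioms and \<open>r\<^sub>n\<close>.\<close>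

datatype word = Gen nat | Op word word

inductive_set words :: "nat \<Rightarrow> word set" for k where
  Gen: "i < k \<Longrightarrow> Gen i \<in> words k"
| Op: "a \<in> words k \<Longrightarrow> b \<in> words k \<Longrightarrow> Op a b \<in> words k"

inductive_set burnside_cong :: "nat \<Rightarrow> nat \<Rightarrow> (word \<times> word) set" for k n where
  refl: "a \<in> words k \<Longrightarrow> (a, a) \<in> burnside_cong k n"
| sym: "(a, b) \<in> burnside_cong k n \<Longrightarrow> (b, a) \<in> burnside_cong k n"
| trans: "(a, b) \<in> burnside_cong k n \<Longrightarrow> (b, c) \<in> burnside_cong k n \<Longrightarrow>
    (a, c) \<in> burnside_cong k n"
| cong: "(a, a') \<in> burnside_cong k n \<Longrightarrow> (b, b') \<in> burnside_cong k n \<Longrightarrow>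
    (Op a b, Op a' b') \<in> burnside_cong k n"
| idem: "a \<in> words k \<Longrightarrow> (Op a a, a) \<in> burnside_cong k n"
| invol: "a \<in> words k \<Longrightarrow> b \<in> words k \<Longrightarrow> (Op (Op a b) b, a) \<in> burnside_cong k n"
| distrib: "a \<in> words k \<Longrightarrow> b \<in> words k \<Longrightarrow> c \<in> words k \<Longrightarrow>
    (Op (Op a b) c, Op (Op a c) (Op b c)) \<in> burnside_cong k n"
| r: "a \<in> words k \<Longrightarrow> b \<in> words k \<Longrightarrow> (a, alternating Op n a b) \<in> burnside_cong k n"

definition universal_burnside_kei :: "nat \<Rightarrow> nat \<Rightarrow> word set set" where
  "universal_burnside_kei k n = words k // burnside_cong k n"

definition universal_burnside_op :: "nat \<Rightarrow> nat \<Rightarrow> word set \<Rightarrow> word set \<Rightarrow> word set" where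
  "universal_burnside_op k n A B = (\<Union>a\<in>A. \<Union>b\<in>B. burnside_cong k n `` {Op a b})"

definition universal_burnside_gen :: "nat \<Rightarrow> nat \<Rightarrow> nat \<Rightarrow> word set" where
  "universal_burnside_gen k n i = burnside_cong k n `` {Gen i}"

text \<open>The rest of this theory verifies that the construction is the free object on \<open>k\<close>
  generators in the class of keis satisfying \<open>r\<^sub>n\<close>.\<close>

lemma alternating_closed:
  assumes "\<And>a b. a \<in> S \<Longrightarrow> b \<in> S \<Longrightarrow> m a b \<in> S" "a \<in> S" "b \<in> S"
  shows "alternating m n a b \<in> S"
  using assms by (induction m n a b rule: alternating.induct) auto

lemma burnside_cong_words:
  "(a, b) \<in> burnside_cong k n \<Longrightarrow> a \<in> words k \<and> b \<in> words k"
  by (induction rule: burnside_cong.induct) (auto intro: words.intros alternating_closed)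

lemma equiv_burnside_cong: "equiv (words k) (burnside_cong k n)"
  using burnside_cong_words
  by (intro equivI) (auto intro!: refl_onI symI transI intro: burnside_cong.intros)

lemma universal_burnside_op_class:
  assumes "a \<in> words k" "b \<in> words k"
  shows "universal_burnside_op k n (burnside_cong k n `` {a}) (burnside_cong k n `` {b}) =
    burnside_cong k n `` {Op a b}"
proof -
  have "burnside_cong k n `` {Op a' b'} = burnside_cong k n `` {Op a b}"
    if "(a, a') \<in> burnside_cong k n" "(b, b') \<in> burnside_cong k n" for a' b'
    using that by (metis burnside_cong.cong equiv_burnside_cong equiv_class_eq)
  moreover have "(a, a) \<in> burnside_cong k n" "(b, b) \<in> burnside_cong k n"
    using assms by (auto intro: burnside_cong.refl)
  ultimately show ?thesis
    unfolding universal_burnside_op_def by blast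
qed

lemma alternating_class:
  assumes "a \<in> words k" "b \<in> words k"
  shows "alternating (universal_burnside_op k n) l
      (burnside_cong k n `` {a}) (burnside_cong k n `` {b}) =
    burnside_cong k n `` {alternating Op l a b}"
  using assms
  by (induction Op l a b rule: alternating.induct)
    (simp_all add: universal_burnside_op_class alternating_closed words.Op)

theorem universal_burnside_kei_is_burnside_kei:
  "burnside_kei (universal_burnside_kei k n) (universal_burnside_op k n) n"
proof -
  let ?c = "\<lambda>w. burnside_cong k n `` {w}"
  note defs = universal_burnside_op_class alternating_class words.Op
  have c_in: "?c w \<in> universal_burnside_kei k n" if "w \<in> words k" for w
    using that by (simp add: universal_burnside_kei_def quotientI)
  have U_c: "\<exists>w \<in> words k. A = ?c w" if "A \<in> universal_burnside_kei k n" for A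
    using that by (auto simp: universal_burnside_kei_def elim: quotientE)
  have eq: "?c a = ?c b" if "(a, b) \<in> burnside_cong k n" for a b
    using that by (rule equiv_class_eq[OF equiv_burnside_cong])
  show ?thesis
  proof (unfold_locales, goal_cases)
    case (1 A B)
    then obtain a b where w: "a \<in> words k" "A = ?c a" "b \<in> words k" "B = ?c b"
      by (meson U_c)
    show ?case by (simp add: w defs c_in)
  next
    case (2 A)
    then obtain a where w: "a \<in> words k" "A = ?c a"
      by (meson U_c)
    show ?case using eq[OF burnside_cong.idem] by (simp add: w defs)
  next
    case (3 A B)
    then obtain a b where w: "a \<in> words k" "A = ?c a" "b \<in> words k" "B = ?c b"
      by (meson U_c)
    show ?case using eq[OF burnside_cong.invol] by (simp add: w defs)
  next
    case (4 A B C)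
    then obtain a b c where w: "a \<in> words k" "A = ?c a" "b \<in> words k" "B = ?c b" "c \<in> words k" "C = ?c c"
      by (meson U_c)
    show ?case using eq[OF burnside_cong.distrib[OF w(1,3,5)]] by (simp add: w defs)
  next
    case (5 A B)
    then obtain a b where w: "a \<in> words k" "A = ?c a" "b \<in> words k" "B = ?c b"
      by (meson U_c)
    show ?case
      unfolding w(2,4) alternating_class[OF w(1,3)] by (rule eq[OF burnside_cong.r[OF w(1,3)]])
  qed
qed

primrec eval :: "('a \<Rightarrow> 'a \<Rightarrow> 'a) \<Rightarrow> (nat \<Rightarrow> 'a) \<Rightarrow> word \<Rightarrow> 'a" where
  "eval m g (Gen i) = g i"
| "eval m g (Op a b) = m (eval m g a) (eval m g b)"

lemma eval_alternating:
  "eval m g (alternating Op n a b) = alternating m n (eval m g a) (eval m g b)"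
  by (induction Op n a b rule: alternating.induct) simp_all

theorem universal_burnside_kei_universal:
  assumes "burnside_kei Q m n" "\<And>i. i < k \<Longrightarrow> g i \<in> Q"
  shows "\<exists>!h. (\<forall>A. A \<notin> universal_burnside_kei k n \<longrightarrow> h A = undefined) \<and>
    (\<forall>A \<in> universal_burnside_kei k n. h A \<in> Q) \<and>
    (\<forall>A \<in> universal_burnside_kei k n. \<forall>B \<in> universal_burnside_kei k n.
      h (universal_burnside_op k n A B) = m (h A) (h B)) \<and>
    (\<forall>i<k. h (universal_burnside_gen k n i) = g i)"
  (is "\<exists>!h. ?E h \<and> ?P h")
proof -
  interpret burnside_kei Q m n by fact
  let ?U = "universal_burnside_kei k n"
  let ?c = "\<lambda>w. burnside_cong k n `` {w}"
  have c_in: "?c w \<in> ?U" if "w \<in> words k" for w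
    using that by (simp add: universal_burnside_kei_def quotientI)
  have U_c: "\<exists>w \<in> words k. A = ?c w" if "A \<in> ?U" for A
    using that by (auto simp: universal_burnside_kei_def elim: quotientE)
  have ev_in: "eval m g w \<in> Q" if "w \<in> words k" for w
    using that by induction (auto intro: assms closed)
  have ev_eq: "eval m g a = eval m g b" if "(a, b) \<in> burnside_cong k n" for a b
    using that
  proof induction
    case (distrib a b c)
    show ?case by (simp add: kei.distrib[OF kei_axioms] ev_in distrib)
  qed (simp_all add: eval_alternating ev_in idem invol flip: r)
  define h where "h A = (if A \<in> ?U then eval m g (SOME w. w \<in> A) else undefined)" for A
  have h_c: "h (?c w) = eval m g w" if "w \<in> words k" for w
  proof -
    have "w \<in> ?c w" using that by (auto intro: burnside_cong.refl)
    then have "(SOME v. v \<in> ?c w) \<in> ?c w" by (rule someI)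
    then show ?thesis using c_in[OF that] ev_eq by (auto simp: h_def)
  qed
  have "?P h"
    using U_c h_c ev_in
    by (auto simp: universal_burnside_gen_def universal_burnside_op_class words.intros
        dest!: U_c)
  moreover have "?E h" by (simp add: h_def)
  moreover have "h' = h" if E: "?E h'" and P: "?P h'" for h'
  proof
    fix A
    have "h' (?c w) = eval m g w" if "w \<in> words k" for w
      using that
    proof induction
      case (Gen i)
      then show ?case using P by (simp add: universal_burnside_gen_def)
    next
      case (Op a b)
      then show ?case
        using P c_in by (simp flip: universal_burnside_op_class)
    qed
    then have "h' A = h A" if "A \<in> ?U"
      using U_c[OF that] h_c by auto
    moreover have "h' A = h A" if "A \<notin> ?U"
      using that E by (simp add: h_def)
    ultimately show "h' A = h A" by blast
  qed
  ultimately show ?thesis by (intro ex1I[of _ h]) blast+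
qed

end

theory Submission
  imports Defs
begin

text \<open>
  Write \<open>S\<^sub>y\<close> for the involution \<open>x \<mapsto> x \<star> y\<close>, so that \<open>S\<^bsub>y \<star> z\<^esub> = S\<^sub>z S\<^sub>y S\<^sub>z\<close>. The relation \<open>r\<^sub>4\<close>
  amounts to \<open>x \<star> y \<star> x = x \<star> y\<close>. Hence \<open>S\<^sub>y\<close> commutes with \<open>S\<^bsub>y \<star> z\<^esub>\<close>, and
  \<open>S\<^sub>y\<close>, \<open>S\<^sub>z\<close> generate a quotient of the dihedral group of order 8 (lemma \<open>dihedral\<close>).

  \<^bold>\<open>At most 96 elements.\<close> Let \<open>a, b, c\<close> generate. Every element is a left-normed product of
  generators, so it lies in the orbit of a generator, and it is enough to see that the
  orbit of \<open>a\<close> has at most 32 elements. The letters \<open>b, c\<close> act through the dihedral group \<open>D\<close>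
  of order 8, and moving the letters \<open>b, c\<close> of a product to its end turns every letter \<open>a\<close>
  into one of the eight conjugates \<open>a \<star> d\<close>, \<open>d \<in> D\<close>. Call the conjugate even if \<open>d\<close> is a
  rotation (a power of \<open>\<rho> = bc\<close>), and odd if \<open>d\<close> is a reflection. An even and an odd
  conjugate differ by a reflection, hence their involutions commute. As the odd ones fix \<open>a\<close>,
  they fix everything that the even ones can reach from \<open>a\<close>. Write \<open>R\<^sub>i\<close> for
  the conjugate of \<open>a\<close> by \<open>\<rho>\<^sup>i\<close>. The dihedral relation for the pair \<open>b \<star> a\<close>, \<open>c\<close>, in which the
  odd conjugates can be dropped, says that applying \<open>R\<^sub>0, R\<^sub>3, R\<^sub>2, R\<^sub>1\<close> in turn is the
  identity on all reachable points (lemma \<open>cyclic_relation\<close>). So the even conjugates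
  act on \<open>{a, a \<star> R\<^sub>1, a \<star> R\<^sub>2, a \<star> R\<^sub>3}\<close> as the translations of a Klein four-group
  (lemma \<open>even_conjugates_table\<close>), and the orbit has at most \<open>4 * 8\<close> elements.

  \<^bold>\<open>At least 96 elements.\<close> The analysis dictates a model of the orbit of \<open>a\<close>: the set of pairs
  \<open>(v, d)\<close> of a Klein four-vector and an element of \<open>D\<close>, on which \<open>b, c\<close> act by right
  multiplication on \<open>d\<close>, and \<open>a\<close> by \<open>(v, d) \<mapsto> (v + \<phi> d, d)\<close>, where \<open>\<phi>\<close> is zero on the
  identity and on reflections and takes the three nonzero values on the other rotations.
  The orbits of \<open>b\<close> and \<open>c\<close> need not be faithful here, and are represented by permutations
  \<open>(v, d) \<mapsto> (v + f d, d r)\<close>. For these the relation \<open>r\<^sub>4\<close> follows from the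
  vanishing of the sum of \<open>f\<close> over each coset of the rotations, a condition which \<open>\<phi>\<close>
  satisfies because the three nonzero vectors sum to zero (theorem \<open>model_burnside_kei\<close>).
  Thus the orbit of \<open>a\<close> has 32 elements, and by symmetry so do those of \<open>b\<close> and \<open>c\<close>. The orbits
  are disjoint as the leftmost letter is an invariant.
\<close>

section \<open>Consequences of the relation \<open>r\<^sub>4\<close>\<close>

locale kei_r4 = burnside_kei Q m 4 for Q :: "'a set" and m (infixl "\<star>" 70)
begin

lemma r4: "x \<in> Q \<Longrightarrow> y \<in> Q \<Longrightarrow> x \<star> y \<star> x \<star> y = x"
  using r[of x y] by (simp add: alternating_4)

lemma absorb: "x \<in> Q \<Longrightarrow> y \<in> Q \<Longrightarrow> x \<star> y \<star> x = x \<star> y"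
  by (metis closed invol r4)

lemma cancel: "x \<in> Q \<Longrightarrow> y \<in> Q \<Longrightarrow> z \<in> Q \<Longrightarrow> x \<star> z = y \<star> z \<longleftrightarrow> x = y"
  by (metis invol)

lemma act_op: "x \<in> Q \<Longrightarrow> y \<in> Q \<Longrightarrow> z \<in> Q \<Longrightarrow> x \<star> (y \<star> z) = x \<star> z \<star> y \<star> z"
  using distrib[of "x \<star> z" y z] by (simp add: closed invol)

text \<open>By absorption \<open>y \<star> z\<close> equals \<open>(y \<star> z) \<star> y\<close>, and acting by the latter is conjugation
  by \<open>y\<close> of the action of the former.\<close>

lemma commute: "x \<in> Q \<Longrightarrow> y \<in> Q \<Longrightarrow> z \<in> Q \<Longrightarrow> x \<star> y \<star> (y \<star> z) = x \<star> (y \<star> z) \<star> y"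
  by (metis absorb act_op closed invol)

lemma fixed: "y \<in> Q \<Longrightarrow> z \<in> Q \<Longrightarrow> y \<star> (y \<star> z) = y"
  by (simp add: act_op idem r4)

text \<open>The relation that \<open>y\<close> and \<open>y \<star> z\<close> commute, written out in the letters \<open>y, z\<close>.\<close>

lemma dihedral:
  "x \<in> Q \<Longrightarrow> y \<in> Q \<Longrightarrow> z \<in> Q \<Longrightarrow> x \<star> z \<star> y \<star> z \<star> y = x \<star> y \<star> z \<star> y \<star> z"
  using commute[of x y z] by (simp add: act_op closed)

lemma power4:
  "x \<in> Q \<Longrightarrow> y \<in> Q \<Longrightarrow> z \<in> Q \<Longrightarrow> x \<star> y \<star> z \<star> y \<star> z \<star> y \<star> z \<star> y \<star> z = x"
  by (simp add: closed invol flip: dihedral[of x y z])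

text \<open>The three relations assumed are those which lemma \<open>cyclic_relation\<close> below provides at
  \<open>a\<close>, \<open>a \<star> R\<^sub>1\<close> and \<open>a \<star> R\<^sub>3\<close>; they
  determine the multiplication table of a Klein four-group.\<close>

lemma klein_table:
  assumes Q: "p \<in> Q" "r \<in> Q" "s \<in> Q" "t \<in> Q"
    and 1: "p \<star> t \<star> s \<star> r = p" and 2: "p \<star> r \<star> t \<star> s \<star> r = p \<star> r" and 3: "p \<star> s \<star> r = p \<star> t"
  shows "p \<star> r \<star> s = p \<star> t" "p \<star> s \<star> r = p \<star> t" "p \<star> r \<star> t = p \<star> s" "p \<star> t \<star> r = p \<star> s"
    "p \<star> s \<star> t = p \<star> r" "p \<star> t \<star> s = p \<star> r"
proof -
  have move: "y \<star> z = x" if "x \<star> z = y" "x \<in> Q" "z \<in> Q" for x y z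
    using that by (auto simp: invol)
  have ts: "p \<star> t \<star> s = p \<star> r"
    using move[OF 1] Q by (simp add: closed)
  have rt: "p \<star> r \<star> t = p \<star> s"
    using 2 move[of "p \<star> r \<star> t" s p] Q by (simp add: closed cancel)
  show "p \<star> r \<star> s = p \<star> t" "p \<star> s \<star> r = p \<star> t" "p \<star> r \<star> t = p \<star> s" "p \<star> t \<star> r = p \<star> s"
    "p \<star> s \<star> t = p \<star> r" "p \<star> t \<star> s = p \<star> r"
    using move[OF ts] move[OF rt] move[OF 3] Q by (simp_all add: closed rt ts 3)
qed

end

section \<open>The orbit of one of three elements\<close>

locale kei_r4_triple = kei_r4 +
  fixes a b c
  assumes abc [simp]: "a \<in> Q" "b \<in> Q" "c \<in> Q"
begin

abbreviation "R\<^sub>1 \<equiv> a \<star> b \<star> c"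
abbreviation "R\<^sub>2 \<equiv> a \<star> b \<star> c \<star> b \<star> c"
abbreviation "R\<^sub>3 \<equiv> a \<star> c \<star> b"

definition "even_conjugates = {a, R\<^sub>1, R\<^sub>2, R\<^sub>3}"
definition "odd_conjugates = {a \<star> b, a \<star> c, a \<star> b \<star> c \<star> b, a \<star> c \<star> b \<star> c}"
definition "dihedral_words = {[], [b], [c], [b,c], [c,b], [b,c,b], [c,b,c], [b,c,b,c]}"

lemma dihedral5: "x \<in> Q \<Longrightarrow> x \<star> b \<star> c \<star> b \<star> c \<star> b = x \<star> c \<star> b \<star> c"
  by (simp add: closed invol flip: dihedral[of _ b c])

text \<open>Products on the right are expanded, and words in \<open>b, c\<close> are brought into the normal form
  of a dihedral group; \<open>dihedral5\<close> resolves the overlap of \<open>dihedral\<close> with \<open>invol\<close>.\<close>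

lemmas normalise = act_op closed invol idem dihedral[of _ b c] dihedral5

lemma in_even_conjugates:
  "a \<in> even_conjugates" "R\<^sub>1 \<in> even_conjugates" "R\<^sub>2 \<in> even_conjugates" "R\<^sub>3 \<in> even_conjugates"
  by (auto simp: even_conjugates_def)

lemma conjugates_closed: "u \<in> even_conjugates \<Longrightarrow> u \<in> Q" "u \<in> odd_conjugates \<Longrightarrow> u \<in> Q"
  by (auto simp: even_conjugates_def odd_conjugates_def closed)

text \<open>The four elements \<open>z\<close> act as the reflections of the dihedral group generated by \<open>b, c\<close>.\<close>

lemma odd_conjugate_of_even:
  assumes "u \<in> even_conjugates" "v \<in> odd_conjugates"
  shows "\<exists>z\<in>{b, c, b \<star> c, c \<star> b}. v = u \<star> z"
  using assms unfolding even_conjugates_def odd_conjugates_def by (auto simp: normalise)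

lemma even_odd_commute:
  "x \<in> Q \<Longrightarrow> u \<in> even_conjugates \<Longrightarrow> v \<in> odd_conjugates \<Longrightarrow> x \<star> u \<star> v = x \<star> v \<star> u"
  using odd_conjugate_of_even[of u v] conjugates_closed commute[of x u] by (auto simp: closed)

definition "fixed_by_odd x \<longleftrightarrow> x \<in> Q \<and> (\<forall>v\<in>odd_conjugates. x \<star> v = x)"

lemma fixed_by_odd_base: "fixed_by_odd a"
  unfolding fixed_by_odd_def
  by (auto dest!: odd_conjugate_of_even[OF in_even_conjugates(1)] simp: fixed closed)

lemma fixed_by_odd_step:
  "fixed_by_odd x \<Longrightarrow> u \<in> even_conjugates \<Longrightarrow> fixed_by_odd (x \<star> u)"
  unfolding fixed_by_odd_def by (simp add: even_odd_commute conjugates_closed closed)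

text \<open>The product of \<open>b \<star> a\<close> and \<open>c\<close> acts as \<open>a b a c = a (b a b) b c\<close>. Collecting
  the rotations \<open>b c\<close> at the end of its fourth power, where they cancel, leaves an alternation
  of even and odd conjugates.\<close>

lemma eight_conjugates:
  "x \<in> Q \<Longrightarrow> x \<star> a \<star> (a \<star> b) \<star> R\<^sub>3 \<star> (a \<star> b \<star> c \<star> b) \<star> R\<^sub>2 \<star> (a \<star> c \<star> b \<star> c) \<star> R\<^sub>1 \<star> (a \<star> c) = x"
  using power4[of x "b \<star> a" c] by (simp add: normalise)

lemma cyclic_relation:
  assumes "fixed_by_odd x"
  shows "x \<star> a \<star> R\<^sub>3 \<star> R\<^sub>2 \<star> R\<^sub>1 = x"
proof -
  have odd: "y \<star> (a \<star> b) = y" "y \<star> (a \<star> c) = y" "y \<star> (a \<star> b \<star> c \<star> b) = y" "y \<star> (a \<star> c \<star> b \<star> c) = y"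
    if "fixed_by_odd y" for y
    using that unfolding fixed_by_odd_def odd_conjugates_def by auto
  have "x \<in> Q" using assms by (simp add: fixed_by_odd_def)
  from eight_conjugates[OF this] show ?thesis
    by (simp add: odd fixed_by_odd_step[OF _ in_even_conjugates(1)]
        fixed_by_odd_step[OF _ in_even_conjugates(2)] fixed_by_odd_step[OF _ in_even_conjugates(3)]
        fixed_by_odd_step[OF _ in_even_conjugates(4)] assms)
qed

lemma R_closed: "R\<^sub>1 \<in> Q" "R\<^sub>2 \<in> Q" "R\<^sub>3 \<in> Q"
  by (simp_all add: closed)

lemma even_conjugates_table:
  "a \<star> R\<^sub>1 \<star> R\<^sub>2 = a \<star> R\<^sub>3" "a \<star> R\<^sub>2 \<star> R\<^sub>1 = a \<star> R\<^sub>3"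
  "a \<star> R\<^sub>1 \<star> R\<^sub>3 = a \<star> R\<^sub>2" "a \<star> R\<^sub>3 \<star> R\<^sub>1 = a \<star> R\<^sub>2"
  "a \<star> R\<^sub>2 \<star> R\<^sub>3 = a \<star> R\<^sub>1" "a \<star> R\<^sub>3 \<star> R\<^sub>2 = a \<star> R\<^sub>1"
proof -
  note fixed_by_odd = fixed_by_odd_base in_even_conjugates fixed_by_odd_step
  have "a \<star> a \<star> R\<^sub>3 \<star> R\<^sub>2 \<star> R\<^sub>1 = a" "a \<star> R\<^sub>1 \<star> a \<star> R\<^sub>3 \<star> R\<^sub>2 \<star> R\<^sub>1 = a \<star> R\<^sub>1"
    "a \<star> R\<^sub>3 \<star> a \<star> R\<^sub>3 \<star> R\<^sub>2 \<star> R\<^sub>1 = a \<star> R\<^sub>3"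
    by (intro cyclic_relation fixed_by_odd)+
  then show "a \<star> R\<^sub>1 \<star> R\<^sub>2 = a \<star> R\<^sub>3" "a \<star> R\<^sub>2 \<star> R\<^sub>1 = a \<star> R\<^sub>3"
    "a \<star> R\<^sub>1 \<star> R\<^sub>3 = a \<star> R\<^sub>2" "a \<star> R\<^sub>3 \<star> R\<^sub>1 = a \<star> R\<^sub>2"
    "a \<star> R\<^sub>2 \<star> R\<^sub>3 = a \<star> R\<^sub>1" "a \<star> R\<^sub>3 \<star> R\<^sub>2 = a \<star> R\<^sub>1"
    using klein_table[OF abc(1) R_closed] by (simp_all only: R_closed abc absorb idem invol)
qed

definition "fibre = {a, a \<star> R\<^sub>1, a \<star> R\<^sub>2, a \<star> R\<^sub>3}"

lemma fibre_closed: "x \<in> fibre \<Longrightarrow> x \<in> Q"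
  by (auto simp: fibre_def closed)

lemma fibre_conjugate:
  assumes x: "x \<in> fibre" and u: "u \<in> even_conjugates \<union> odd_conjugates"
  shows "x \<star> u \<in> fibre"
proof (cases "u \<in> odd_conjugates")
  case True
  have "fixed_by_odd x"
    using x unfolding fibre_def
    by (auto intro: fixed_by_odd_base fixed_by_odd_step in_even_conjugates)
  then show ?thesis using True x by (simp add: fixed_by_odd_def)
next
  case False
  then have "u \<in> {a, R\<^sub>1, R\<^sub>2, R\<^sub>3}" using u by (auto simp: even_conjugates_def)
  then show ?thesis using x unfolding fibre_def
    by (elim insertE emptyE)
      (simp_all add: even_conjugates_table invol R_closed absorb idem)
qed

text \<open>That this is the whole orbit of \<open>a\<close> is the content of lemma \<open>orbit_closed\<close>.\<close>

definition "orbit = (\<lambda>(x, w). foldl (\<star>) x w) ` (fibre \<times> dihedral_words)"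

lemma orbitI: "x \<in> fibre \<Longrightarrow> w \<in> dihedral_words \<Longrightarrow> y = foldl (\<star>) x w \<Longrightarrow> y \<in> orbit"
  unfolding orbit_def by force

lemma finite_orbit: "finite orbit"
  by (simp add: orbit_def fibre_def dihedral_words_def)

lemma card_orbit: "card orbit \<le> 32"
proof -
  have "card orbit \<le> card (fibre \<times> dihedral_words)"
    unfolding orbit_def by (rule card_image_le) (simp add: fibre_def dihedral_words_def)
  also have "\<dots> \<le> 4 * 8"
    unfolding card_cartesian_product
    by (rule mult_le_mono) (simp_all add: fibre_def dihedral_words_def card_insert_if)
  finally show ?thesis by simp
qed

lemma base_in_orbit: "a \<in> orbit"
  by (rule orbitI[of a "[]"]) (simp_all add: fibre_def dihedral_words_def)

lemma orbit_closed:
  assumes "y \<in> orbit" "g \<in> {a, b, c}"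
  shows "y \<star> g \<in> orbit"
proof -
  obtain x w where xw: "x \<in> fibre" "w \<in> dihedral_words" "y = foldl (\<star>) x w"
    using assms(1) by (auto simp: orbit_def)
  have x: "x \<in> Q" using xw fibre_closed by auto
  consider "g = a" | "g = b" | "g = c" using assms by auto
  then show ?thesis
  proof cases
    case 1
    \<comment> \<open>Moving \<open>a\<close> to the left past the word \<open>w\<close> conjugates it by the inverse of \<open>w\<close>.\<close>
    let ?u = "foldl (\<star>) a (rev w)"
    have "?u \<in> even_conjugates \<union> odd_conjugates"
      using xw(2) unfolding dihedral_words_def even_conjugates_def odd_conjugates_def
      by (auto simp: normalise)
    moreover have "y \<star> a = foldl (\<star>) (x \<star> ?u) w"
      using xw(2) x unfolding xw(3) dihedral_words_def
      by (elim insertE emptyE) (simp_all add: normalise)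
    ultimately show ?thesis using xw fibre_conjugate 1 by (auto intro: orbitI)
  next
    case 2
    have "\<exists>v\<in>dihedral_words. foldl (\<star>) x w \<star> b = foldl (\<star>) x v"
      using xw(2) x unfolding dihedral_words_def by (elim insertE emptyE) (simp_all add: normalise)
    then show ?thesis using xw 2 by (auto intro: orbitI)
  next
    case 3
    have "\<exists>v\<in>dihedral_words. foldl (\<star>) x w \<star> c = foldl (\<star>) x v"
      using xw(2) x unfolding dihedral_words_def by (elim insertE emptyE) (simp_all add: normalise)
    then show ?thesis using xw 3 by (auto intro: orbitI)
  qed
qed

end

section \<open>The upper bound\<close>

abbreviation (input) "U \<equiv> universal_burnside_kei 3 4"
abbreviation (input) "U_op \<equiv> universal_burnside_op 3 4"
abbreviation (input) "U_gen \<equiv> universal_burnside_gen 3 4"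
abbreviation (input) "U_class w \<equiv> burnside_cong 3 4 `` {w}"

lemma U_class_in: "w \<in> words 3 \<Longrightarrow> U_class w \<in> U"
  by (simp add: universal_burnside_kei_def quotientI)

lemma U_cases:
  assumes "A \<in> U" obtains w where "w \<in> words 3" "A = U_class w"
  using assms by (auto simp: universal_burnside_kei_def elim: quotientE)

lemma U_gen_in: "i < 3 \<Longrightarrow> U_gen i \<in> U"
  by (simp add: universal_burnside_gen_def U_class_in words.Gen)

interpretation U: kei_r4 U U_op
  by (rule kei_r4.intro) (rule universal_burnside_kei_is_burnside_kei)

text \<open>A product on the right can be expanded by \<open>act_op\<close>, so only generators have to be checked.\<close>

lemma closed_under_generators:
  assumes w: "w \<in> words 3" and "S \<subseteq> U"
    and gen: "\<And>x i. x \<in> S \<Longrightarrow> i < 3 \<Longrightarrow> U_op x (U_gen i) \<in> S"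
    and "x \<in> S"
  shows "U_op x (U_class w) \<in> S"
  using w \<open>x \<in> S\<close>
proof (induction arbitrary: x)
  case (Gen i)
  then show ?case using gen by (simp add: universal_burnside_gen_def)
next
  case (Op v w)
  then have "x \<in> U" using \<open>S \<subseteq> U\<close> by blast
  then have "U_op x (U_class (Op v w)) = U_op (U_op (U_op x (U_class w)) (U_class v)) (U_class w)"
    using Op.hyps U.act_op[of x "U_class v" "U_class w"]
    by (simp add: universal_burnside_op_class U_class_in)
  then show ?case using Op by simp
qed

lemma U_generated:
  assumes "S \<subseteq> U" "\<And>i. i < 3 \<Longrightarrow> U_gen i \<in> S"
    and gen: "\<And>x i. x \<in> S \<Longrightarrow> i < 3 \<Longrightarrow> U_op x (U_gen i) \<in> S"
  shows "S = U"
proof -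
  have "U_class w \<in> S" if "w \<in> words 3" for w
    using that
  proof induction
    case (Gen i)
    then show ?case using assms(2) by (simp add: universal_burnside_gen_def)
  next
    case (Op v w)
    then have "U_op (U_class v) (U_class w) \<in> S"
      by (intro closed_under_generators assms(1) gen)
    then show ?case using Op.hyps by (simp add: universal_burnside_op_class)
  qed
  then show ?thesis using \<open>S \<subseteq> U\<close> by (auto elim: U_cases)
qed

lemma U_upper_bound: "finite U \<and> card U \<le> 96"
proof -
  define orbit where "orbit i j k = kei_r4_triple.orbit U_op (U_gen i) (U_gen j) (U_gen k)" for i j k
  have triple: "kei_r4_triple U U_op (U_gen i) (U_gen j) (U_gen k)"
    if "i < 3" "j < 3" "k < 3" for i j k
    using that by unfold_locales (simp_all add: U_gen_in)
  note orbit_facts = kei_r4_triple.finite_orbit[OF triple, folded orbit_def]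
    kei_r4_triple.card_orbit[OF triple, folded orbit_def]
    kei_r4_triple.base_in_orbit[OF triple, folded orbit_def]
    kei_r4_triple.orbit_closed[OF triple, folded orbit_def]
  have orbit_U: "x \<in> U" if "x \<in> orbit i j k" "i < 3" "j < 3" "k < 3" for x i j k
  proof -
    interpret T: kei_r4_triple U U_op "U_gen i" "U_gen j" "U_gen k" by (rule triple) fact+
    have "x \<in> T.orbit" using that(1) by (simp only: orbit_def)
    then obtain y w where "y \<in> T.fibre" "w \<in> T.dihedral_words" "x = foldl U_op y w"
      unfolding T.orbit_def by auto
    then show ?thesis
      using T.fibre_closed[of y] by (auto simp: T.dihedral_words_def U.closed)
  qed
  have orbit_gen: "U_op x (U_gen l) \<in> orbit i j k"
    if "x \<in> orbit i j k" "i < 3" "j < 3" "k < 3" "l = i \<or> l = j \<or> l = k" for x i j k l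
    using orbit_facts(4)[of i j k x "U_gen l"] that by auto
  define S where "S = orbit 0 1 2 \<union> orbit 1 2 0 \<union> orbit 2 0 1"
  have "S = U"
  proof (rule U_generated)
    show "S \<subseteq> U" unfolding S_def using orbit_U by auto
    fix i :: nat assume "i < 3"
    then have i: "i = 0 \<or> i = 1 \<or> i = 2" by auto
    then show "U_gen i \<in> S" unfolding S_def using orbit_facts(3) by auto
    show "U_op x (U_gen i) \<in> S" if "x \<in> S" for x
      using i that unfolding S_def by (elim UnE disjE) (simp_all add: orbit_gen)
  qed
  moreover have "finite S" unfolding S_def by (simp add: orbit_facts(1))
  moreover have "card S \<le> 32 + 32 + 32"
    unfolding S_def by (intro order.trans[OF card_Un_le] add_mono orbit_facts(2)) simp_all
  ultimately show ?thesis by simp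
qed

section \<open>The dihedral group of order 8 and the Klein four-group\<close>

text \<open>The triple \<open>D8 x y s\<close> stands for the product of the reflection of the square
  in the first axis if \<open>x\<close>, in the second axis if \<open>y\<close>, and in the diagonal if \<open>s\<close>.\<close>

datatype d8 = D8 bool bool bool
datatype klein = V bool bool

fun add :: "klein \<Rightarrow> klein \<Rightarrow> klein" (infixl "\<oplus>" 65) where
  "V x y \<oplus> V x' y' = V (x \<noteq> x') (y \<noteq> y')"

abbreviation zero :: klein where "zero \<equiv> V False False"

lemma add_assoc: "u \<oplus> v \<oplus> w = u \<oplus> (v \<oplus> w)"
  and add_commute: "u \<oplus> v = v \<oplus> u"
  and add_zero [simp]: "u \<oplus> zero = u" "zero \<oplus> u = u"
  and add_self [simp]: "u \<oplus> u = zero" "u \<oplus> (u \<oplus> v) = v"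
  by (cases u; cases v; cases w; auto)+

lemma add_left_commute: "u \<oplus> (v \<oplus> w) = v \<oplus> (u \<oplus> w)"
  by (metis add_assoc add_commute)

lemmas add_ac = add_assoc add_commute add_left_commute

lemma add_eq_zero: "u \<oplus> v = zero \<longleftrightarrow> u = v"
  by (metis add_self add_zero(1))

fun mul :: "d8 \<Rightarrow> d8 \<Rightarrow> d8" (infixl "\<odot>" 75) where
  "D8 x y s \<odot> D8 x' y' s' =
    D8 (x \<noteq> (if s then y' else x')) (y \<noteq> (if s then x' else y')) (s \<noteq> s')"

abbreviation one :: d8 where "one \<equiv> D8 False False False"

fun inverse_d8 :: "d8 \<Rightarrow> d8" where
  "inverse_d8 (D8 x y s) = (if s then D8 y x s else D8 x y s)"

fun reflection :: "d8 \<Rightarrow> bool" where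
  "reflection (D8 x y s) \<longleftrightarrow> (x \<noteq> (y \<noteq> s))"

lemma mul_assoc: "p \<odot> q \<odot> r = p \<odot> (q \<odot> r)"
  by (cases p; cases q; cases r) auto

lemma mul_one: "p \<odot> one = p" "one \<odot> p = p"
  by (cases p; simp)+

lemma mul_inverse_d8:
  "p \<odot> inverse_d8 p = one" "q \<odot> p \<odot> inverse_d8 p = q" "q \<odot> inverse_d8 p \<odot> p = q"
  "inverse_d8 p \<odot> p = one" "inverse_d8 (p \<odot> q) = inverse_d8 q \<odot> inverse_d8 p"
  by (cases p; cases q; auto)+

lemma reflection_square:
  "reflection r \<Longrightarrow> r \<odot> r = one" "reflection r \<Longrightarrow> p \<odot> r \<odot> r = p"
  by (cases r; cases p; auto)+

lemma reflection_inverse: "reflection r \<Longrightarrow> inverse_d8 r = r"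
  by (cases r; auto)

lemma reflection_mul:
  "reflection (p \<odot> q) \<longleftrightarrow> reflection p \<noteq> reflection q" "reflection (inverse_d8 p) = reflection p"
  by (cases p; cases q; auto)+

text \<open>Products are normalised to associate to the left, since the functions below are
  invariant under a multiplication on the right.\<close>

lemmas d8_simps =
  mul_assoc[symmetric] mul_one mul_inverse_d8 reflection_square reflection_inverse

lemma reflection_cases:
  assumes "reflection r"
  obtains "r = D8 True False False" | "r = D8 False True False"
    | "r = D8 False False True" | "r = D8 True True True"
  using assms by (cases r) auto

lemma d8_cases:
  obtains "d = one" | "d = D8 True True False" | "d = D8 True False True" | "d = D8 False True True"
    | "reflection d"
  by (cases d) auto

lemma reflection_dihedral:
  "reflection r \<Longrightarrow> reflection s \<Longrightarrow> r \<odot> s \<odot> r \<odot> s \<odot> r = s \<odot> r \<odot> s"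
  by (elim reflection_cases) simp_all

lemma mul_reflection_dihedral:
  "reflection r \<Longrightarrow> reflection s \<Longrightarrow> d \<odot> r \<odot> s \<odot> r \<odot> s \<odot> r = d \<odot> s \<odot> r \<odot> s"
  using reflection_dihedral[of r s] by (simp add: mul_assoc)

text \<open>On rotations, the analysis of the orbit forces this up to a choice of coordinates: the
  even conjugate \<open>a\<close> fixes \<open>a\<close>, and the other three move it to three further points.\<close>

fun \<phi> :: "d8 \<Rightarrow> klein" where
  "\<phi> (D8 x y s) = (if reflection (D8 x y s) then zero else V x y)"

lemma phi_one [simp]: "\<phi> one = zero"
  by simp

lemma phi_reflection: "reflection r \<Longrightarrow> \<phi> r = zero"
  by (cases r) auto

section \<open>Functions with sum zero over the cosets of the rotations\<close>

text \<open>The first sum ranges over the rotations, the second one over the reflections.\<close>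

definition zero_sum :: "(d8 \<Rightarrow> klein) set" where
  "zero_sum = {f.
     f one \<oplus> f (D8 False True True) \<oplus> f (D8 True False True) \<oplus> f (D8 True True False) = zero \<and>
     f (D8 False False True) \<oplus> f (D8 True False False) \<oplus> f (D8 False True False)
       \<oplus> f (D8 True True True) = zero}"

lemma zero_sum_zero: "(\<lambda>_. zero) \<in> zero_sum"
  by (simp add: zero_sum_def)

lemma zero_sum_add:
  assumes "f \<in> zero_sum" "g \<in> zero_sum"
  shows "(\<lambda>d. f d \<oplus> g d) \<in> zero_sum"
proof -
  have regroup: "(u \<oplus> u') \<oplus> (v \<oplus> v') \<oplus> (w \<oplus> w') \<oplus> (x \<oplus> x') =
      (u \<oplus> v \<oplus> w \<oplus> x) \<oplus> (u' \<oplus> v' \<oplus> w' \<oplus> x')" for u u' v v' w w' x x'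
    by (simp only: add_ac)
  show ?thesis using assms unfolding zero_sum_def mem_Collect_eq regroup by simp
qed

lemma zero_sum_shift: "f \<in> zero_sum \<Longrightarrow> (\<lambda>d. f (d \<odot> p)) \<in> zero_sum"
  by (cases p rule: d8_cases; (elim reflection_cases)?) (simp_all add: zero_sum_def add_ac)

lemma zero_sum_shift2: "f \<in> zero_sum \<Longrightarrow> (\<lambda>d. f (d \<odot> p \<odot> q)) \<in> zero_sum"
  using zero_sum_shift[of f "p \<odot> q"] by (simp add: mul_assoc)

lemma zero_sum_shift_left: "f \<in> zero_sum \<Longrightarrow> (\<lambda>d. f (p \<odot> d)) \<in> zero_sum"
  by (cases p rule: d8_cases; (elim reflection_cases)?) (simp_all add: zero_sum_def add_ac)

lemma zero_sum_phi: "\<phi> \<in> zero_sum"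
  by (simp add: zero_sum_def)

text \<open>The four arguments are \<open>d\<close> times the powers of the rotation \<open>r \<odot> s\<close>. If its order is 4
  they exhaust a coset of the rotations; otherwise each value occurs an even number of times.\<close>

lemma zero_sum_cyclic:
  assumes "f \<in> zero_sum" "reflection r" "reflection s"
  shows "f d \<oplus> (f (d \<odot> r \<odot> s) \<oplus> (f (d \<odot> s \<odot> r) \<oplus> f (d \<odot> r \<odot> s \<odot> r \<odot> s))) = zero"
proof -
  have "g one \<oplus> (g (r \<odot> s) \<oplus> (g (s \<odot> r) \<oplus> g (r \<odot> s \<odot> r \<odot> s))) = zero" if "g \<in> zero_sum" for g
    using assms(2,3) that by (elim reflection_cases) (simp_all add: zero_sum_def add_ac)
  from this[OF zero_sum_shift_left[OF assms(1)], of d] show ?thesis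
    by (simp add: mul_one mul_assoc)
qed

text \<open>From here on only the group laws are needed, and unfolding coordinates would split cases.\<close>

declare mul.simps [simp del] \<phi>.simps [simp del] reflection.simps [simp del]
  inverse_d8.simps [simp del] add.simps [simp del]

section \<open>A model\<close>

text \<open>\<open>Refl f r\<close> stands for the permutation \<open>Pt v d \<mapsto> Pt (v \<oplus> f d) (d \<odot> r)\<close>, and acts by
  it. A point \<open>Pt w e\<close> acts as the conjugate by \<open>e\<close> of the translation by \<open>\<phi>\<close>; the
  coordinate \<open>w\<close> does not enter since translations commute. On
  permutations the operation is conjugation by these two kinds of involutions.\<close>

datatype model = is_Pt: Pt klein d8 | Refl "d8 \<Rightarrow> klein" d8

fun model_op :: "model \<Rightarrow> model \<Rightarrow> model" (infixl "\<triangleleft>" 70) where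
  "Pt v d \<triangleleft> Pt w e = Pt (v \<oplus> \<phi> (d \<odot> inverse_d8 e)) d"
| "Pt v d \<triangleleft> Refl f r = Pt (v \<oplus> f d) (d \<odot> r)"
| "Refl f r \<triangleleft> Pt w e =
    Refl (\<lambda>d. f d \<oplus> (\<phi> (d \<odot> inverse_d8 e) \<oplus> \<phi> (d \<odot> r \<odot> inverse_d8 e))) r"
| "Refl f r \<triangleleft> Refl g s = Refl (\<lambda>d. g d \<oplus> (f (d \<odot> s) \<oplus> g (d \<odot> s \<odot> r))) (s \<odot> r \<odot> s)"

text \<open>Invariance of \<open>f\<close> under \<open>r\<close> makes \<open>Refl f r\<close> an involution.\<close>

definition model_kei :: "model set" where
  "model_kei = {Pt v d | v d. True} \<union>
    {Refl f r | f r. reflection r \<and> f \<in> zero_sum \<and> (\<forall>d. f (d \<odot> r) = f d)}"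

lemma Pt_in_model: "Pt v d \<in> model_kei"
  and Refl_in_model:
    "Refl f r \<in> model_kei \<longleftrightarrow> reflection r \<and> f \<in> zero_sum \<and> (\<forall>d. f (d \<odot> r) = f d)"
  by (auto simp: model_kei_def)

lemma model_cases:
  assumes "x \<in> model_kei"
  obtains v d where "x = Pt v d"
  | f r where "x = Refl f r" "reflection r" "f \<in> zero_sum" "\<And>d. f (d \<odot> r) = f d"
  using assms by (auto simp: model_kei_def)

text \<open>The fourth power of the product of the two permutations translates by sums of \<open>f\<close>
  and of \<open>g\<close> over the powers of the rotation \<open>r \<odot> s\<close>.\<close>

lemma Refl_r4:
  assumes f: "f \<in> zero_sum" "\<And>d. f (d \<odot> r) = f d" "reflection r"
    and g: "g \<in> zero_sum" "\<And>d. g (d \<odot> s) = g d" "reflection s"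
  shows "Refl f r \<triangleleft> Refl g s \<triangleleft> Refl f r \<triangleleft> Refl g s = Refl f r"
proof -
  have rs: "s \<odot> r \<odot> s \<odot> r \<odot> s \<odot> r \<odot> s = r"
    using reflection_dihedral[OF g(3) f(3)] f(3) g(3) by (simp add: d8_simps)
  have eq: "g d \<oplus> (f (d \<odot> s) \<oplus> (g (d \<odot> r) \<oplus> (f (d \<odot> r \<odot> s) \<oplus> (g (d \<odot> s \<odot> r) \<oplus>
    (f (d \<odot> s \<odot> r \<odot> s) \<oplus> g (d \<odot> s \<odot> r \<odot> s \<odot> r)))))) = f d" for d
  proof -
    have "f (d \<odot> r \<odot> s \<odot> r \<odot> s) = f (d \<odot> s \<odot> r \<odot> s)"
      using mul_reflection_dihedral[OF f(3) g(3), of d] by (metis f(2))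
    then have "f d = f (d \<odot> r \<odot> s) \<oplus> (f (d \<odot> s) \<oplus> f (d \<odot> s \<odot> r \<odot> s))"
      using zero_sum_cyclic[OF f(1,3) g(3), of d] by (simp add: f add_eq_zero)
    moreover have "g d = g (d \<odot> s \<odot> r) \<oplus> (g (d \<odot> r) \<oplus> g (d \<odot> s \<odot> r \<odot> s \<odot> r))"
      using zero_sum_cyclic[OF g(1,3) f(3), of d] by (simp add: g add_eq_zero)
    ultimately show ?thesis by (simp add: add_ac)
  qed
  show ?thesis
    using f g
    by (simp add: d8_simps add_ac rs mul_reflection_dihedral) (rule ext, rule eq)
qed

theorem model_burnside_kei: "burnside_kei model_kei (\<triangleleft>) 4"
proof
  fix x y assume xy: "x \<in> model_kei" "y \<in> model_kei"
  show "x \<triangleleft> y \<in> model_kei"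
    by (rule model_cases[OF xy(1)]; rule model_cases[OF xy(2)])
      (simp_all add: Pt_in_model Refl_in_model add_ac reflection_mul d8_simps
        zero_sum_add zero_sum_shift zero_sum_phi zero_sum_shift2)
  show "x \<triangleleft> y \<triangleleft> y = x"
    by (rule model_cases[OF xy(1)]; rule model_cases[OF xy(2)])
      (simp_all add: d8_simps add_ac)
  have "x \<triangleleft> y \<triangleleft> x \<triangleleft> y = x"
    by (rule model_cases[OF xy(1)]; rule model_cases[OF xy(2)])
      (simp_all only: Refl_r4, simp_all add: d8_simps add_ac phi_reflection reflection_mul)
  then show "x = alternating (\<triangleleft>) 4 x y"
    by (simp add: alternating_4)
next
  fix x assume x: "x \<in> model_kei"
  show "x \<triangleleft> x = x" by (rule model_cases[OF x]) (simp_all add: d8_simps)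
next
  fix x y z assume xyz: "x \<in> model_kei" "y \<in> model_kei" "z \<in> model_kei"
  show "x \<triangleleft> y \<triangleleft> z = x \<triangleleft> z \<triangleleft> (y \<triangleleft> z)"
    by (rule model_cases[OF xyz(1)]; rule model_cases[OF xyz(2)]; rule model_cases[OF xyz(3)])
      (simp_all add: d8_simps add_ac)
qed

abbreviation "model_a \<equiv> Pt zero one"
abbreviation "model_b \<equiv> Refl (\<lambda>_. zero) (D8 False False True)"
abbreviation "model_c \<equiv> Refl (\<lambda>_. zero) (D8 True False False)"

text \<open>The generators \<open>b, c\<close> reach every \<open>d\<close> from any other one, and \<open>a\<close> translates a point
  over \<open>d\<close> by \<open>\<phi> d\<close>, which can be any vector.\<close>

lemma points_generated:
  assumes closed: "\<And>x y. x \<in> I \<Longrightarrow> y \<in> I \<Longrightarrow> x \<triangleleft> y \<in> I"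
    and gens: "model_a \<in> I" "model_b \<in> I" "model_c \<in> I"
  shows "Pt v d \<in> I"
proof -
  let ?b = "D8 False False True" and ?c = "D8 True False False"
  have b: "Pt v (d \<odot> ?b) \<in> I" and c: "Pt v (d \<odot> ?c) \<in> I" if "Pt v d \<in> I" for v d
    using closed[OF that gens(2)] closed[OF that gens(3)] by simp_all
  have bcb: "Pt v (d \<odot> D8 False True False) \<in> I" if "Pt v d \<in> I" for v d
    using b[OF c[OF b[OF that]]] by (simp add: mul_assoc mul.simps)
  have shift: "Pt v (d \<odot> D8 x y s) \<in> I" if "Pt v d \<in> I" for v d x y s
  proof -
    define d\<^sub>1 where "d\<^sub>1 = (if x then d \<odot> ?c else d)"
    define d\<^sub>2 where "d\<^sub>2 = (if y then d\<^sub>1 \<odot> D8 False True False else d\<^sub>1)"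
    have "Pt v d\<^sub>1 \<in> I" using c that by (simp add: d\<^sub>1_def)
    then have "Pt v d\<^sub>2 \<in> I" using bcb by (simp add: d\<^sub>2_def)
    then have "Pt v (if s then d\<^sub>2 \<odot> ?b else d\<^sub>2) \<in> I" using b by simp
    moreover have "(if s then d\<^sub>2 \<odot> ?b else d\<^sub>2) = d \<odot> D8 x y s"
      unfolding d\<^sub>1_def d\<^sub>2_def by (cases x; cases y; cases s; cases d) (simp_all add: mul.simps)
    ultimately show ?thesis by simp
  qed
  have any: "Pt v e \<in> I" if "Pt v d \<in> I" for v d e
  proof -
    obtain x y s where "inverse_d8 d \<odot> e = D8 x y s" by (cases "inverse_d8 d \<odot> e")
    then have "d \<odot> D8 x y s = e"
      by (metis mul_assoc mul_inverse_d8(1) mul_one(2))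
    then show ?thesis using shift[OF that, of x y s] by simp
  qed
  have translate: "Pt (v \<oplus> \<phi> d) one \<in> I" if "Pt v one \<in> I" for v d
  proof (rule any)
    show "Pt (v \<oplus> \<phi> d) d \<in> I"
      using closed[OF any[OF that, of d] gens(1)] by (simp add: inverse_d8.simps mul_one)
  qed
  obtain x y where v: "v = V x y" by (cases v)
  \<comment> \<open>The last coordinate is chosen so as to obtain a rotation.\<close>
  have "\<phi> (D8 x y (x \<noteq> y)) = v"
    unfolding v by (cases x; cases y) (simp_all add: \<phi>.simps reflection.simps)
  then have "Pt v one \<in> I" using translate[OF gens(1), of "D8 x y (x \<noteq> y)"] by simp
  then show ?thesis by (rule any)
qed

lemma card_points: "card {Pt v d | v d. True} = 32"
proof -
  let ?f = "\<lambda>(x, y, x', y', s). Pt (V x y) (D8 x' y' s)"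
  have "{Pt v d | v d. True} = range ?f"
  proof (intro equalityI subsetI)
    fix p assume "p \<in> {Pt v d | v d. True}"
    then obtain v d where p: "p = Pt v d" by auto
    obtain x y x' y' s where "v = V x y" "d = D8 x' y' s" by (cases v; cases d)
    then have "p = ?f (x, y, x', y', s)" by (simp add: p)
    then show "p \<in> range ?f" by (rule range_eqI)
  qed auto
  moreover have "inj ?f" by (auto simp: inj_def)
  ultimately have "card {Pt v d | v d. True} = card (UNIV :: (bool \<times> bool \<times> bool \<times> bool \<times> bool) set)"
    by (simp add: card_image)
  also have "\<dots> = 32"
    by (simp add: card_cartesian_product flip: UNIV_Times_UNIV)
  finally show ?thesis .
qed

section \<open>The lower bound\<close>

primrec leftmost :: "word \<Rightarrow> nat" where
  "leftmost (Gen i) = i"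
| "leftmost (Op v w) = leftmost v"

lemma is_Pt_op: "is_Pt (x \<triangleleft> y) \<longleftrightarrow> is_Pt x"
  by (cases x; cases y) simp_all

text \<open>One of the three generators is mapped to \<open>model_a\<close>, the other two to \<open>model_b\<close> and
  \<open>model_c\<close>. The points then single out the words with that leftmost letter, because
  the operation of the model preserves the kind of its left argument.\<close>

lemma leftmost_class_card:
  assumes "i < 3"
  defines "B \<equiv> {U_class w | w. w \<in> words 3 \<and> leftmost w = i}"
  shows "32 \<le> card B"
    and "\<And>w. w \<in> words 3 \<Longrightarrow> U_class w \<in> B \<Longrightarrow> leftmost w = i"
proof -
  define j where "j = (if i = 0 then 1 else 0 :: nat)"
  define k where "k = (if i = 2 then 1 else 2 :: nat)"
  have ijk: "j < 3" "k < 3" "i \<noteq> j" "i \<noteq> k" "j \<noteq> k"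
    by (auto simp: j_def k_def)
  define g where "g l = (if l = i then model_a else if l = j then model_b else model_c)" for l
  have "g l \<in> model_kei" for l
    by (simp add: g_def Pt_in_model Refl_in_model zero_sum_zero reflection.simps)
  then obtain h where hom: "\<And>A B. A \<in> U \<Longrightarrow> B \<in> U \<Longrightarrow> h (U_op A B) = h A \<triangleleft> h B"
    and gen: "\<And>l. l < 3 \<Longrightarrow> h (U_gen l) = g l"
    using ex1_implies_ex[OF universal_burnside_kei_universal[OF model_burnside_kei, of 3 g]] by blast
  have is_Pt_h: "is_Pt (h (U_class w)) \<longleftrightarrow> leftmost w = i" if "w \<in> words 3" for w
    using that
  proof induction
    case (Gen l)
    then show ?case using gen[of l] by (simp add: universal_burnside_gen_def g_def)
  next
    case (Op v w)
    then show ?case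
      using hom[of "U_class v" "U_class w"]
      by (simp add: universal_burnside_op_class U_class_in is_Pt_op)
  qed
  show "leftmost w = i" if "w \<in> words 3" "U_class w \<in> B" for w
  proof -
    note w = that
    obtain w' where "U_class w = U_class w'" "w' \<in> words 3" "leftmost w' = i"
      using w(2) unfolding B_def by auto
    then show ?thesis using is_Pt_h[of w] is_Pt_h[of w'] w(1) by simp
  qed
  have "B \<subseteq> U" by (auto simp: B_def U_class_in)
  then have "finite B" using U_upper_bound finite_subset by blast
  have gens: "g l \<in> h ` U" if "l < 3" for l
    using gen[OF that] U_gen_in[OF that] by (metis imageI)
  have points: "Pt v d \<in> h ` U" for v d
  proof (rule points_generated)
    show "x \<triangleleft> y \<in> h ` U" if "x \<in> h ` U" "y \<in> h ` U" for x y
      using that hom U.closed by (auto simp flip: hom)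
    show "model_a \<in> h ` U" "model_b \<in> h ` U" "model_c \<in> h ` U"
      using gens[of i] gens[of j] gens[of k] ijk \<open>i < 3\<close> by (simp_all add: g_def)
  qed
  have "Pt v d \<in> h ` B" for v d
  proof -
    obtain A where A: "A \<in> U" "h A = Pt v d" using points by (metis imageE)
    then obtain w where w: "w \<in> words 3" "A = U_class w" by (auto elim: U_cases)
    then have "leftmost w = i" using A is_Pt_h[of w] by simp
    then have "A \<in> B" using w by (auto simp: B_def)
    then show ?thesis using A(2) by (metis imageI)
  qed
  then have "{Pt v d | v d. True} \<subseteq> h ` B"
    by auto
  then have "card {Pt v d | v d. True} \<le> card B"
    using \<open>finite B\<close> by (rule surj_card_le[rotated])
  then show "32 \<le> card B" by (simp only: card_points)
qed

theorem mainTheorem3: "card (universal_burnside_kei 3 4) = 96"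
proof -
  define B where "B i = {U_class w | w. w \<in> words 3 \<and> leftmost w = i}" for i
  note B = leftmost_class_card[folded B_def]
  have sub: "B i \<subseteq> U" for i by (auto simp: B_def U_class_in)
  then have fin: "finite (B i)" for i using U_upper_bound finite_subset by blast
  have "B i \<inter> B j = {}" if "i < 3" "j < 3" "i \<noteq> j" for i j
    using B(2)[OF that(2)] that(3) unfolding B_def[of i] by auto
  then have "card (\<Union>i<3. B i) = (\<Sum>i<3. card (B i))"
    using fin by (intro card_UN_disjoint) auto
  also have "\<dots> \<ge> (\<Sum>i<(3::nat). 32)"
    by (intro sum_mono B(1)) simp
  finally have "96 \<le> card (\<Union>i<3. B i)" by simp
  also have "\<dots> \<le> card U"
    using sub U_upper_bound by (intro card_mono) auto
  finally show ?thesis using U_upper_bound by simp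
qed

end
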